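(* Let $P=\{y_1,\ldots,y_d\}$ be a finite partially ordered set with $d\ge 1$ elements, and let $\mathcal{Q}_P\subset\mathbb{R}^d$ be the associated Fano polytope (defined in the context). Then $\mathcal{Q}_P$ is terminal.
   Context: Let $P=\{y_1,\ldots,y_d\}$ be a finite partially ordered set with $d$ elements and $\hat P=P\cup\{\hat 0,\hat 1\}$, where $\hat 0\notin P$ is adjoined as the unique minimal element and $\hat 1\notin P$ as the unique maximal element of $\hat P$. Write $y_0=\hat 0$, $y_{d+1}=\hat 1$. An edge of $\hat P$ is an edge of the Hasse diagram of $\hat P$, i.e. a pair $\{y_i,y_j\}$ with $y_i<y_j$ in $\hat P$ and no $z\in P$ with $y_i<z<y_j$. Let $\mathbf{e}_i$ be the $i$th canonical unit coordinate vector of $\mathbb{R}^d$. For an edge $e=\{y_i,y_j\}$ of $\hat P$ with $y_i<y_j$, define $\rho(e)\in\mathbb{R}^d$ by $\rho(e)=\mathbf{e}_i$ if $j=d+1$; $\rho(e)=-\mathbf{e}_j$ if $i=0$; $\rho(e)=\mathbf{e}_i-\mathbf{e}_j$ if $1\le i,j\le d$. The polytope $\mathcal{Q}_P\subset\mathbb{R}^d$ is the convex hull of $\{\rho(e): e \text{ is an edge of } \hat P\}$. An integral polytope is a convex polytope all of whose vertices have integer coordinates. A Fano polytope in $\mathbb{R}^d$ is an integral convex polytope of dimension $d$ such that the origin is the unique integer point belonging to its interior. (It is a fact that $\mathcal{Q}_P$ is a Fano polytope.) A Fano polytope is called terminal if each integer point belonging to its boundary is a vertex of it. *)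

theory Defs
  imports "HOL-Analysis.Analysis"
begin

(* The poset P is a partial order r on the whole of a finite type 'n, and the same
   type indexes the coordinates of real ^ 'n: the element i of 'n is both y_i and the
   index of the unit vector e_i, so d = CARD('n) >= 1.  The order need not be total. *)

datatype 'n hat = Bot | Elt 'n | Top

definition hat_le :: "'n rel \<Rightarrow> 'n hat \<Rightarrow> 'n hat \<Rightarrow> bool" where
  "hat_le r x y \<longleftrightarrow> x = Bot \<or> y = Top \<or> (\<exists>i j. x = Elt i \<and> y = Elt j \<and> (i, j) \<in> r)"

definition hat_less :: "'n rel \<Rightarrow> 'n hat \<Rightarrow> 'n hat \<Rightarrow> bool" where
  "hat_less r x y \<longleftrightarrow> hat_le r x y \<and> x \<noteq> y"

(* A Hasse edge is stored as the ordered pair (lower end, upper end). *)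
definition hat_edges :: "'n rel \<Rightarrow> ('n hat \<times> 'n hat) set" where
  "hat_edges r =
     {(x, y). hat_less r x y \<and> \<not> (\<exists>z. hat_less r x (Elt z) \<and> hat_less r (Elt z) y)}"

(* (Bot, Top) is never an edge because 'n is nonempty, so the value on the remaining
   pairs is irrelevant. *)
fun rho :: "'n hat \<times> 'n hat \<Rightarrow> real ^ 'n" where
  "rho (Elt i, Top) = axis i 1"
| "rho (Bot, Elt j) = - axis j 1"
| "rho (Elt i, Elt j) = axis i 1 - axis j 1"
| "rho _ = 0"

definition poset_polytope :: "'n::finite rel \<Rightarrow> (real ^ 'n) set" where
  "poset_polytope r = convex hull (rho ` hat_edges r)"

definition integer_point :: "real ^ 'n \<Rightarrow> bool" where
  "integer_point x \<longleftrightarrow> (\<forall>i. x $ i \<in> \<int>)"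

definition integral_polytope :: "(real ^ 'n::finite) set \<Rightarrow> bool" where
  "integral_polytope Q \<longleftrightarrow> polytope Q \<and> (\<forall>v. v extreme_point_of Q \<longrightarrow> integer_point v)"

definition Fano_polytope :: "(real ^ 'n::finite) set \<Rightarrow> bool" where
  "Fano_polytope Q \<longleftrightarrow>
     integral_polytope Q \<and> aff_dim Q = int CARD('n) \<and>
     {x \<in> interior Q. integer_point x} = {0}"

definition terminal_Fano_polytope :: "(real ^ 'n::finite) set \<Rightarrow> bool" where
  "terminal_Fano_polytope Q \<longleftrightarrow>
     Fano_polytope Q \<and>
     (\<forall>x \<in> frontier Q. integer_point x \<longrightarrow> x extreme_point_of Q)"

end

theory Submission
  imports Defs
begin

text \<open>
  The argument encloses the polytope in a larger body. Every vector \<open>\<rho>(e)\<close> is \<open>\<plusminus>e\<^sub>i\<close> or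
  \<open>e\<^sub>i - e\<^sub>j\<close>, so each coordinate and each sum of two distinct coordinates lies in \<open>[-1,1]\<close>.
  These conditions are linear, hence hold on the whole convex hull; call the body that they cut
  out \<open>K\<close> (\<open>pair_sum_body\<close>). A nonzero integer point \<open>x\<close> of \<open>K\<close> has some coordinate
  \<open>x\<^sub>i = \<plusminus>1\<close>. It is pinned down by the functionals that attain \<open>\<plusminus>1\<close> at \<open>x\<close>: a coordinate that
  is nonzero is itself such a functional, and a coordinate \<open>k\<close> that vanishes is the difference of
  two, \<open>x\<^sub>i + x\<^sub>k\<close> and \<open>x\<^sub>i\<close>. A functional bounded by \<open>1\<close> in absolute value that attains \<open>\<plusminus>1\<close> at
  an inner point of a segment is constant on the segment, so \<open>x\<close> is an extreme point of \<open>K\<close>, and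
  therefore of every subset of \<open>K\<close> containing it
  (\<open>nonzero_integer_point_extreme\<close>). Consequently a nonzero integer point of the polytope is
  a vertex; in particular it is not interior.

  It remains to see that the origin is interior (\<open>zero_in_interior_poset_polytope\<close>), which
  also gives full dimension and excludes the origin from the boundary. Otherwise a
  nonzero vector \<open>a\<close> satisfies \<open>a \<bullet> \<rho>(e) \<ge> 0\<close> for every edge \<open>e\<close>. With the value
  \<open>0\<close> at the two adjoined elements, the coordinates of \<open>a\<close> then weakly decrease upwards
  along every edge of the Hasse diagram. Climbing from an element to the top shows that its coordinate is
  nonnegative, descending to the bottom that it is nonpositive; so \<open>a = 0\<close>, a contradiction.
\<close>

section \<open>Integer points of a body containing the polytope\<close>

definition pair_sum_body :: "(real ^ 'n::finite) set" where
  "pair_sum_body = {x. (\<forall>i. \<bar>x $ i\<bar> \<le> 1) \<and> (\<forall>i j. i \<noteq> j \<longrightarrow> \<bar>x $ i + x $ j\<bar> \<le> 1)}"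

lemma convex_pair_sum_body: "convex (pair_sum_body :: (real ^ 'n::finite) set)"
proof -
  have bound: "\<bar>u * p + v * q\<bar> \<le> 1"
    if "0 \<le> u" "0 \<le> v" "u + v = 1" "\<bar>p\<bar> \<le> 1" "\<bar>q\<bar> \<le> 1" for u v p q :: real
    using convexD[OF convex_real_interval(5)[of "-1" "1"], of p q u v] that
    by (simp add: abs_le_iff)
  show ?thesis
  proof (rule convexI)
    fix x y :: "real ^ 'n" and u v :: real
    assume x: "x \<in> pair_sum_body" and y: "y \<in> pair_sum_body"
      and uv: "0 \<le> u" "0 \<le> v" "u + v = 1"
    have "\<bar>u * x $ i + v * y $ i\<bar> \<le> 1" for i
      using bound[OF uv] x y by (simp add: pair_sum_body_def)
    moreover have "\<bar>u * (x $ i + x $ j) + v * (y $ i + y $ j)\<bar> \<le> 1" if "i \<noteq> j" for i j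
      using bound[OF uv] x y that by (simp add: pair_sum_body_def)
    ultimately show "u *\<^sub>R x + v *\<^sub>R y \<in> pair_sum_body"
      by (simp add: pair_sum_body_def algebra_simps)
  qed
qed

lemma unit_modulus_convex_combination:
  fixes p q t :: real
  assumes "0 < t" "t < 1" "\<bar>p\<bar> \<le> 1" "\<bar>q\<bar> \<le> 1" "\<bar>(1 - t) * p + t * q\<bar> = 1"
  shows "p = (1 - t) * p + t * q" "q = (1 - t) * p + t * q"
proof -
  have pos: "p = 1 \<and> q = 1"
    if "\<bar>p\<bar> \<le> 1" "\<bar>q\<bar> \<le> 1" "(1 - t) * p + t * q = 1" for p q :: real
  proof -
    have "(1 - t) * (1 - p) + t * (1 - q) = 0"
      using that by (simp add: algebra_simps)
    moreover have "0 \<le> (1 - t) * (1 - p)" "0 \<le> t * (1 - q)"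
      using assms that by simp_all
    ultimately have "(1 - t) * (1 - p) = 0" "t * (1 - q) = 0"
      by linarith+
    then show ?thesis
      using assms by simp
  qed
  have "p = q"
  proof (cases "(1 - t) * p + t * q = 1")
    case True
    then show ?thesis
      using pos[of p q] assms by simp
  next
    case False
    then have "(1 - t) * (- p) + t * (- q) = 1"
      using assms(5) by (auto simp: abs_if split: if_splits)
    then show ?thesis
      using pos[of "- p" "- q"] assms by simp
  qed
  then show "p = (1 - t) * p + t * q" "q = (1 - t) * p + t * q"
    by (simp_all add: algebra_simps)
qed

lemma integer_in_unit_interval:
  fixes x :: real
  assumes "x \<in> \<int>" "\<bar>x\<bar> \<le> 1" "x \<noteq> 0"
  shows "\<bar>x\<bar> = 1"
  using assms by (auto elim!: Ints_cases)

text \<open>The functionals \<open>u \<mapsto> u\<^sub>k\<close> with \<open>x\<^sub>k \<noteq> 0\<close>, together with \<open>u \<mapsto> u\<^sub>i + u\<^sub>k\<close> for one fixed \<open>i\<close>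
  with \<open>x\<^sub>i \<noteq> 0\<close> and all \<open>k\<close> with \<open>x\<^sub>k = 0\<close>, are tight at \<open>x\<close> and determine all coordinates.\<close>

lemma nonzero_integer_point_extreme:
  fixes x :: "real ^ 'n::finite"
  assumes sub: "Q \<subseteq> pair_sum_body" and xQ: "x \<in> Q" and int: "integer_point x" and "x \<noteq> 0"
  shows "x extreme_point_of Q"
  unfolding extreme_point_of_def
proof (intro conjI ballI notI)
  show "x \<in> Q" by (rule xQ)
next
  fix u v assume u: "u \<in> Q" and v: "v \<in> Q" and "x \<in> open_segment u v"
  then obtain t where "u \<noteq> v" and t: "0 < t" "t < 1" and x: "x = (1 - t) *\<^sub>R u + t *\<^sub>R v"
    by (auto simp: in_segment)
  have xk: "x $ k = (1 - t) * u $ k + t * v $ k" for k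
    by (simp add: x)
  have unit: "\<bar>x $ k\<bar> = 1" if "x $ k \<noteq> 0" for k
    using integer_in_unit_interval[of "x $ k"] that sub xQ int
    by (auto simp: pair_sum_body_def integer_point_def)
  obtain i where i: "x $ i \<noteq> 0"
    using \<open>x \<noteq> 0\<close> by (auto simp: vec_eq_iff)
  have nonzero: "u $ k = x $ k \<and> v $ k = x $ k" if "x $ k \<noteq> 0" for k
  proof -
    have "\<bar>u $ k\<bar> \<le> 1" "\<bar>v $ k\<bar> \<le> 1"
      using sub u v by (auto simp: pair_sum_body_def)
    then show ?thesis
      using unit_modulus_convex_combination[OF t, of "u $ k" "v $ k"] unit[OF that]
      by (simp add: xk)
  qed
  have "u $ k = x $ k \<and> v $ k = x $ k" for k
  proof (cases "x $ k = 0")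
    case True
    then have "i \<noteq> k"
      using i by auto
    then have "\<bar>u $ i + u $ k\<bar> \<le> 1" "\<bar>v $ i + v $ k\<bar> \<le> 1"
      using sub u v by (auto simp: pair_sum_body_def)
    moreover have sum: "(1 - t) * (u $ i + u $ k) + t * (v $ i + v $ k) = x $ i"
      using True by (simp add: xk algebra_simps)
    ultimately have "u $ i + u $ k = x $ i" "v $ i + v $ k = x $ i"
      using unit_modulus_convex_combination[OF t, of "u $ i + u $ k" "v $ i + v $ k"] unit[OF i]
      by simp_all
    then show ?thesis
      using nonzero[OF i] True by simp
  qed (rule nonzero)
  then have "u = v"
    by (simp add: vec_eq_iff)
  with \<open>u \<noteq> v\<close> show False ..
qed

lemma rho_in_pair_sum_body: "rho e \<in> pair_sum_body"
  by (cases e rule: rho.cases) (auto simp: pair_sum_body_def axis_def)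

lemma poset_polytope_subset_pair_sum_body: "poset_polytope r \<subseteq> pair_sum_body"
  unfolding poset_polytope_def
  by (rule hull_minimal) (auto simp: rho_in_pair_sum_body convex_pair_sum_body)

lemma integer_point_rho: "integer_point (rho e)"
  by (cases e rule: rho.cases) (auto simp: integer_point_def axis_def)

section \<open>The Hasse diagram\<close>

text \<open>Climbing along covering relations reaches a maximal element, because the order is finite.\<close>

lemma nonneg_if_decreasing_along_covers:
  fixes r :: "'n::finite rel" and f :: "'n \<Rightarrow> real"
  assumes po: "partial_order_on UNIV r"
    and maximal: "\<And>k. (\<And>j. (k, j) \<in> r \<Longrightarrow> j = k) \<Longrightarrow> 0 \<le> f k"
    and cover: "\<And>k j. \<lbrakk>(k, j) \<in> r; k \<noteq> j; \<And>z. \<lbrakk>(k, z) \<in> r; (z, j) \<in> r\<rbrakk> \<Longrightarrow> z = k \<or> z = j\<rbrakk>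
                  \<Longrightarrow> f j \<le> f k"
  shows "0 \<le> f k"
proof -
  have acyc: "acyclic (r - Id)"
    using po by (rule partial_order_on_acyclic)
  then have wf: "wf (r - Id)" and wf_conv: "wf ((r - Id)\<inverse>)"
    by (auto intro: finite_acyclic_wf finite_acyclic_wf_converse)
  show ?thesis
    using wf_conv
  proof (induction k rule: wf_induct_rule)
    case (less k)
    show ?case
    proof (cases "\<exists>j. (k, j) \<in> r - Id")
      case False
      then show ?thesis
        by (intro maximal) auto
    next
      case True
      \<comment> \<open>A minimal element above \<open>k\<close> covers \<open>k\<close>.\<close>
      then obtain j where j: "(k, j) \<in> r - Id"
        and min: "\<And>z. (z, j) \<in> r - Id \<Longrightarrow> (k, z) \<notin> r - Id"
        using wfE_min[OF wf, of _ "{j. (k, j) \<in> r - Id}"] by auto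
      have "f j \<le> f k"
        using j min by (intro cover) auto
      moreover have "0 \<le> f j"
        using less j by auto
      ultimately show ?thesis
        by linarith
    qed
  qed
qed

lemma cover_edge:
  assumes "(i, j) \<in> r" "i \<noteq> j" "\<And>z. \<lbrakk>(i, z) \<in> r; (z, j) \<in> r\<rbrakk> \<Longrightarrow> z = i \<or> z = j"
  shows "(Elt i, Elt j) \<in> hat_edges r"
  using assms by (auto simp: hat_edges_def hat_less_def hat_le_def)

lemma maximal_edge:
  assumes "\<And>j. (i, j) \<in> r \<Longrightarrow> j = i"
  shows "(Elt i, Top) \<in> hat_edges r"
  using assms by (auto simp: hat_edges_def hat_less_def hat_le_def)

lemma minimal_edge:
  assumes "\<And>j. (j, i) \<in> r \<Longrightarrow> j = i"
  shows "(Bot, Elt i) \<in> hat_edges r"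
  using assms by (auto simp: hat_edges_def hat_less_def hat_le_def)

text \<open>In dual form, this says that the edge vectors span the whole space with nonnegative
  coefficients. The two signs of the conclusion come from the order and from its converse.\<close>

lemma nonneg_on_edges_imp_zero:
  fixes r :: "'n::finite rel" and a :: "real ^ 'n"
  assumes po: "partial_order_on UNIV r"
    and nonneg: "\<And>e. e \<in> hat_edges r \<Longrightarrow> 0 \<le> a \<bullet> rho e"
  shows "a = 0"
proof -
  have inner: "a \<bullet> axis i 1 = a $ i" for i
    by (simp add: inner_axis)
  have "0 \<le> a $ k" for k
    using po
  proof (rule nonneg_if_decreasing_along_covers)
    show "0 \<le> a $ k" if "\<And>j. (k, j) \<in> r \<Longrightarrow> j = k" for k
      using nonneg[OF maximal_edge[of k r, OF that]] by (simp add: inner)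
    show "a $ j \<le> a $ k"
      if "(k, j) \<in> r" "k \<noteq> j" "\<And>z. \<lbrakk>(k, z) \<in> r; (z, j) \<in> r\<rbrakk> \<Longrightarrow> z = k \<or> z = j" for k j
      using nonneg[OF cover_edge[of k j r, OF that]] by (simp add: inner inner_diff_right)
  qed
  moreover have "0 \<le> - a $ k" for k
  proof (rule nonneg_if_decreasing_along_covers[of "r\<inverse>"])
    show "partial_order_on UNIV (r\<inverse>)"
      using po by simp
    show "0 \<le> - a $ k" if "\<And>j. (k, j) \<in> r\<inverse> \<Longrightarrow> j = k" for k
      using nonneg[OF minimal_edge[of k r]] that by (simp add: inner)
    show "- a $ j \<le> - a $ k"
      if "(k, j) \<in> r\<inverse>" "k \<noteq> j" "\<And>z. \<lbrakk>(k, z) \<in> r\<inverse>; (z, j) \<in> r\<inverse>\<rbrakk> \<Longrightarrow> z = k \<or> z = j" for k j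
    proof -
      have "(Elt j, Elt k) \<in> hat_edges r"
        using that by (intro cover_edge) auto
      from nonneg[OF this] show ?thesis
        by (simp add: inner inner_diff_right)
    qed
  qed
  ultimately show ?thesis
    by (simp add: vec_eq_iff order.antisym)
qed

section \<open>The origin is an interior point\<close>

text \<open>If the interior is empty, \<open>Q\<close> lies in a hyperplane, one side of which contains the origin;
  otherwise the interior can be separated from the origin, and \<open>Q\<close> lies in its closure.\<close>

lemma zero_not_interior_halfspace:
  fixes Q :: "'a::euclidean_space set"
  assumes "convex Q" "0 \<notin> interior Q"
  obtains a where "a \<noteq> 0" "\<And>x. x \<in> Q \<Longrightarrow> 0 \<le> a \<bullet> x"
proof (cases "interior Q = {}")
  case True
  obtain a b where a: "a \<noteq> 0" and "Q \<subseteq> {x. a \<bullet> x = b}"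
    using empty_interior_subset_hyperplane[OF \<open>convex Q\<close> True] by blast
  then have b: "a \<bullet> x = b" if "x \<in> Q" for x
    using that by blast
  show ?thesis
  proof (cases "0 \<le> b")
    case True
    then show ?thesis
      using that[of a] a b by simp
  next
    case False
    then show ?thesis
      using that[of "- a"] a b by simp
  qed
next
  case False
  obtain a where a: "a \<noteq> 0" and "\<forall>x \<in> interior Q. 0 \<le> a \<bullet> x"
    using separating_hyperplane_set_0[OF convex_interior[OF \<open>convex Q\<close>] \<open>0 \<notin> interior Q\<close>] by blast
  then have "closure (interior Q) \<subseteq> {x. 0 \<le> a \<bullet> x}"
    by (intro closure_minimal closed_Collect_le continuous_intros) auto
  then have "Q \<subseteq> {x. 0 \<le> a \<bullet> x}"
    using convex_closure_interior[OF \<open>convex Q\<close> False] closure_subset[of Q] by simp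
  then show ?thesis
    using that[OF a] by auto
qed

lemma zero_in_interior_poset_polytope:
  fixes r :: "'n::finite rel"
  assumes po: "partial_order_on UNIV r"
  shows "0 \<in> interior (poset_polytope r)"
proof (rule ccontr)
  assume "0 \<notin> interior (poset_polytope r)"
  then obtain a where "a \<noteq> 0" and a: "\<And>x. x \<in> poset_polytope r \<Longrightarrow> 0 \<le> a \<bullet> x"
    using zero_not_interior_halfspace[of "poset_polytope r"]
    by (auto simp: poset_polytope_def)
  have "0 \<le> a \<bullet> rho e" if "e \<in> hat_edges r" for e
    using that by (intro a) (auto simp: poset_polytope_def intro: hull_inc)
  then have "a = 0"
    by (rule nonneg_on_edges_imp_zero[OF po])
  with \<open>a \<noteq> 0\<close> show False ..
qed

section \<open>The polytope is terminal\<close>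

lemma finite_hat_edges: "finite (hat_edges (r :: 'n::finite rel))"
proof -
  have "x \<in> insert Bot (insert Top (range Elt))" for x :: "'n hat"
    by (cases x) auto
  moreover have "finite (insert Bot (insert Top (range (Elt :: 'n \<Rightarrow> 'n hat))))"
    by simp
  ultimately have "finite (UNIV :: 'n hat set)"
    by (blast intro: finite_subset)
  then have "finite (UNIV \<times> UNIV :: ('n hat \<times> 'n hat) set)"
    by (intro finite_cartesian_product)
  then show ?thesis
    by (rule rev_finite_subset) simp
qed

lemma integral_poset_polytope: "integral_polytope (poset_polytope r)"
  by (auto simp: integral_polytope_def poset_polytope_def polytope_convex_hull finite_hat_edges
      integer_point_rho dest!: extreme_point_of_convex_hull)

theorem lemma1p4:
  fixes r :: "'n::finite rel"
  assumes "partial_order_on UNIV r"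
  shows "terminal_Fano_polytope (poset_polytope r)"
proof -
  let ?Q = "poset_polytope r"
  have zero: "0 \<in> interior ?Q"
    using assms by (rule zero_in_interior_poset_polytope)
  have extreme: "x extreme_point_of ?Q" if "x \<in> ?Q" "integer_point x" "x \<noteq> 0" for x
    using poset_polytope_subset_pair_sum_body that by (rule nonzero_integer_point_extreme)
  have "aff_dim ?Q = int CARD('n)"
    using aff_dim_nonempty_interior[of ?Q] zero by auto
  moreover have "{x \<in> interior ?Q. integer_point x} = {0}"
    using zero extreme extreme_point_not_in_interior interior_subset[of ?Q]
    by (auto simp: integer_point_def)
  moreover have "x extreme_point_of ?Q" if x: "x \<in> frontier ?Q" "integer_point x" for x
  proof (rule extreme)
    have "closed ?Q"
      using integral_poset_polytope[of r] by (simp add: integral_polytope_def polytope_imp_closed)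
    then show "x \<in> ?Q"
      using x by (simp add: frontier_def)
    show "x \<noteq> 0"
      using x zero by (auto simp: frontier_def)
  qed fact
  ultimately show ?thesis
    by (simp add: terminal_Fano_polytope_def Fano_polytope_def integral_poset_polytope)
qed

end
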